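(* The power sum symmetric functions expand into the basis generated by the family of stars $\{S_n\}_{n\ge1}$ via, for every partition $\lambda$, $$p_\lambda = \sum_{\alpha \subseteq \lambda} (-1)^{|\alpha|-\ell(\lambda)} \binom{\lambda_1-1}{\alpha_1-1}\cdots\binom{\lambda_{\ell(\lambda)}-1}{\alpha_{\ell(\lambda)}-1} X_{S_{\widetilde{\alpha}\cdot(1^{|\lambda|-|\alpha|})}}$$ and similarly $$X_{S_\lambda} = \sum_{\alpha \subseteq \lambda} (-1)^{|\alpha|-\ell(\lambda)} \binom{\lambda_1-1}{\alpha_1-1}\cdots\binom{\lambda_{\ell(\lambda)}-1}{\alpha_{\ell(\lambda)}-1} p_{\widetilde{\alpha}\cdot(1^{|\lambda|-|\alpha|})}$$ where the sums are over compositions $\alpha$ and $\alpha \subseteq \lambda$ means $\ell(\alpha)=\ell(\lambda)$ and $\alpha_1\le \lambda_1,\dots,\alpha_{\ell(\lambda)}\le \lambda_{\ell(\lambda)}$.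
   Context: A composition $\alpha=(\alpha_1,\dots,\alpha_{\ell(\alpha)})$ is a finite ordered list of positive integers, with length $\ell(\alpha)$ and size $|\alpha|=\sum_i\alpha_i$; a partition is a composition with weakly decreasing parts. $\widetilde\alpha$ is the partition obtained by sorting the parts of $\alpha$ into weakly decreasing order; $\cdot$ denotes concatenation of compositions, and $(1^m)$ is the composition with $m$ parts equal to $1$. The power sum symmetric functions are $p_i=\sum_j x_j^i$ and $p_\lambda=\prod_i p_{\lambda_i}$. $S_n$ ($n\ge1$) is the star on $n$ vertices $v_1,\dots,v_n$ with edge set $\{v_iv_n\mid 1\le i\le n-1\}$, and for a partition $\lambda$, $S_\lambda$ is the disjoint union $S_{\lambda_1}\cup\cdots\cup S_{\lambda_{\ell(\lambda)}}$. The chromatic symmetric function of a graph $G$ with vertices $v_1,\dots,v_n$ is $X_G=\sum_\kappa x_{\kappa(v_1)}\cdots x_{\kappa(v_n)}$, summed over all proper colourings $\kappa:V(G)\to\mathbb{Z}^+$ (maps with $\kappa(u)\ne\kappa(v)$ whenever $uv$ is an edge). The family $\{X_{S_\lambda}\}_{\lambda\vdash n\ge0}$ is a basis of the algebra of symmetric functions. *)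

theory Defs
  imports Complex_Main "HOL-Library.Multiset" "HOL-Library.FuncSet"
begin

text \<open>
  A monomial in the commuting variables \<open>x\<^sub>j\<close> is encoded as the finite multiset of the indices of
  its variables, so that multiplication of monomials is union of multisets. A power series is an
  arbitrary family of coefficients indexed by monomials.
\<close>

typedef 'a mps = "UNIV :: (nat multiset \<Rightarrow> 'a) set"
  morphisms mps_coeff Abs_mps ..

lemma mps_coeff_Abs [simp]: "mps_coeff (Abs_mps f) m = f m"
  by (simp add: Abs_mps_inverse)

lemma mps_eqI: "(\<And>m. mps_coeff f m = mps_coeff g m) \<Longrightarrow> f = g"
  by (simp add: mps_coeff_inject [symmetric] fun_eq_iff)

lemma finite_submultisets [simp]: "finite {a. a \<subseteq># (m :: 'b multiset)}"
proof (induction m)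
  case (add x m)
  have "{a. a \<subseteq># add_mset x m} \<subseteq> {a. a \<subseteq># m} \<union> add_mset x ` {a. a \<subseteq># m}"
  proof
    fix a assume a: "a \<in> {a. a \<subseteq># add_mset x m}"
    show "a \<in> {a. a \<subseteq># m} \<union> add_mset x ` {a. a \<subseteq># m}"
    proof (cases "x \<in># a")
      case True
      then obtain b where "a = add_mset x b" by (meson mset_add)
      with a show ?thesis by auto
    next
      case False
      have "count a y \<le> count m y" for y
        using a False mset_subset_eq_count [of a "add_mset x m" y]
        by (cases "y = x") (auto simp: not_in_iff)
      then have "a \<subseteq># m" by (simp add: subseteq_mset_def)
      then show ?thesis by simp
    qed
  qed
  then show ?case by (rule finite_subset) (use add in simp)
qed simp

instantiation mps :: (comm_ring_1) comm_ring_1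
begin

definition "0 = Abs_mps (\<lambda>m. 0)"
definition "1 = Abs_mps (\<lambda>m. if m = {#} then 1 else 0)"
definition "f + g = Abs_mps (\<lambda>m. mps_coeff f m + mps_coeff g m)"
definition "f - g = Abs_mps (\<lambda>m. mps_coeff f m - mps_coeff g m)"
definition "- f = Abs_mps (\<lambda>m. - mps_coeff f m)"
definition "f * g = Abs_mps (\<lambda>m. \<Sum>a | a \<subseteq># m. mps_coeff f a * mps_coeff g (m - a))"

instance
proof
  fix f g h :: "'a mps"
  show "f * g = g * f"
  proof (rule mps_eqI)
    fix m
    have "(\<Sum>a | a \<subseteq># m. mps_coeff f a * mps_coeff g (m - a)) =
          (\<Sum>a | a \<subseteq># m. mps_coeff g a * mps_coeff f (m - a))"
      by (rule sum.reindex_bij_witness [of _ "\<lambda>a. m - a" "\<lambda>a. m - a"])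
         (auto simp: subset_mset.diff_diff_right mult.commute)
    then show "mps_coeff (f * g) m = mps_coeff (g * f) m"
      by (simp add: times_mps_def)
  qed
  show "f * g * h = f * (g * h)"
  proof (rule mps_eqI)
    fix m :: "nat multiset"
    have sub1: "b + c \<subseteq># m" if "b \<subseteq># m" "c \<subseteq># m - b" for b c
      using that by (metis add.commute subset_mset.le_diff_conv2)
    have sub2: "a - b \<subseteq># m - b" if "a \<subseteq># m" for a b
      using that by (simp add: subseteq_mset_def diff_le_mono)
    have dif: "m - b - (a - b) = m - a" if "b \<subseteq># a" for a b
      using that by (metis diff_diff_add subset_mset.add_diff_inverse)
    have "(\<Sum>(a, b) \<in> (SIGMA a:{a. a \<subseteq># m}. {b. b \<subseteq># a}).
             mps_coeff f b * mps_coeff g (a - b) * mps_coeff h (m - a)) =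
          (\<Sum>(b, c) \<in> (SIGMA b:{b. b \<subseteq># m}. {c. c \<subseteq># m - b}).
             mps_coeff f b * (mps_coeff g c * mps_coeff h (m - b - c)))"
      by (rule sum.reindex_bij_witness
            [of _ "\<lambda>(b, c). (b + c, b)" "\<lambda>(a, b). (b, a - b)"])
         (auto simp: mult.assoc sub1 sub2 dif intro: subset_mset.order_trans)
    then show "mps_coeff (f * g * h) m = mps_coeff (f * (g * h)) m"
      by (simp add: times_mps_def sum_distrib_left sum_distrib_right sum.Sigma)
  qed
  show "1 * f = f"
  proof (rule mps_eqI)
    fix m
    have "(\<Sum>a | a \<subseteq># m. (if a = {#} then 1 else 0) * mps_coeff f (m - a)) =
          (\<Sum>a | a \<subseteq># m. if a = {#} then mps_coeff f m else 0)"
      by (rule sum.cong) auto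
    then show "mps_coeff (1 * f) m = mps_coeff f m"
      by (simp add: times_mps_def one_mps_def)
  qed
  show "(f + g) * h = f * h + g * h"
    by (rule mps_eqI) (simp add: times_mps_def plus_mps_def distrib_right sum.distrib)
  show "(0::'a mps) \<noteq> 1"
  proof
    assume "(0::'a mps) = 1"
    then have "mps_coeff (0::'a mps) {#} = mps_coeff 1 {#}" by simp
    then show False by (simp add: zero_mps_def one_mps_def)
  qed
qed (auto intro!: mps_eqI
       simp: plus_mps_def zero_mps_def minus_mps_def uminus_mps_def algebra_simps)

end

definition mps_monom :: "nat multiset \<Rightarrow> 'a::comm_ring_1 mps" where
  "mps_monom M = Abs_mps (\<lambda>m. if m = M then 1 else 0)"

definition mps_var :: "nat \<Rightarrow> 'a::comm_ring_1 mps" where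
  "mps_var j = mps_monom {#j#}"

text \<open>
  Infinite sums of power series are taken coefficientwise. Such a sum is meaningful only if each
  monomial occurs in finitely many summands.
\<close>

definition mps_summable :: "('i \<Rightarrow> 'a::comm_ring_1 mps) \<Rightarrow> 'i set \<Rightarrow> bool" where
  "mps_summable f I \<longleftrightarrow> (\<forall>m. finite {i \<in> I. mps_coeff (f i) m \<noteq> 0})"

definition mps_infsum :: "('i \<Rightarrow> 'a::comm_ring_1 mps) \<Rightarrow> 'i set \<Rightarrow> 'a mps" where
  "mps_infsum f I = Abs_mps (\<lambda>m. \<Sum>i | i \<in> I \<and> mps_coeff (f i) m \<noteq> 0. mps_coeff (f i) m)"

lemma mps_monom_empty: "mps_monom {#} = 1"
  by (simp add: mps_monom_def one_mps_def)

lemma mps_monom_mult: "mps_monom M * mps_monom N = (mps_monom (M + N) :: 'a::comm_ring_1 mps)"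
proof (rule mps_eqI)
  fix m
  have "(\<Sum>a | a \<subseteq># m. (if a = M then 1 else 0) * (if m - a = N then 1 else (0::'a))) =
        (\<Sum>a | a \<subseteq># m. if a = M then (if m - M = N then 1 else 0) else 0)"
    by (rule sum.cong) auto
  also have "\<dots> = (if m = M + N then 1 else 0)"
    by (auto simp: subset_mset.add_diff_inverse)
  finally show "mps_coeff (mps_monom M * mps_monom N) m = mps_coeff (mps_monom (M + N) :: 'a mps) m"
    by (simp add: times_mps_def mps_monom_def)
qed

lemma mps_var_power: "mps_var j ^ i = mps_monom (replicate_mset i j)"
  by (induction i) (simp_all add: mps_monom_empty mps_var_def mps_monom_mult)

lemma mps_prod_var:
  "finite V \<Longrightarrow> (\<Prod>v\<in>V. mps_var (c v)) = mps_monom (image_mset c (mset_set V))"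
  by (induction V rule: finite_induct) (simp_all add: mps_monom_empty mps_var_def mps_monom_mult)

definition composition :: "nat list \<Rightarrow> bool" where
  "composition \<alpha> \<longleftrightarrow> (\<forall>a \<in> set \<alpha>. 1 \<le> a)"

definition int_partition :: "nat list \<Rightarrow> bool" where
  "int_partition \<mu> \<longleftrightarrow> composition \<mu> \<and> sorted_wrt (\<ge>) \<mu>"

definition sort_desc :: "nat list \<Rightarrow> nat list" where
  "sort_desc \<alpha> = rev (sort \<alpha>)"

definition contained_in :: "nat list \<Rightarrow> nat list \<Rightarrow> bool" where
  "contained_in \<alpha> \<mu> \<longleftrightarrow> length \<alpha> = length \<mu> \<and> (\<forall>i < length \<mu>. \<alpha> ! i \<le> \<mu> ! i)"

text \<open>
  The variables are \<open>x\<^sub>1, x\<^sub>2, \<dots>\<close>; the index \<open>0\<close> is never used. The power sum below is the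
  intended one for \<open>i \<ge> 1\<close> only: for \<open>i = 0\<close> the sum is not summable.
\<close>

definition power_sum :: "nat \<Rightarrow> 'a::comm_ring_1 mps" where
  "power_sum i = mps_infsum (\<lambda>j. mps_var j ^ i) {1..}"

definition power_sums :: "nat list \<Rightarrow> 'a::comm_ring_1 mps" where
  "power_sums \<mu> = prod_list (map power_sum \<mu>)"

lemma power_sum_summable:
  assumes "1 \<le> i"
  shows "mps_summable (\<lambda>j. mps_var j ^ i :: 'a::comm_ring_1 mps) {1..}"
  unfolding mps_summable_def
proof
  fix m :: "nat multiset"
  have "{j \<in> {1..}. mps_coeff (mps_var j ^ i :: 'a mps) m \<noteq> 0} \<subseteq> set_mset m"
    using assms by (auto simp: mps_var_power mps_monom_def)
  then show "finite {j \<in> {1..}. mps_coeff (mps_var j ^ i :: 'a mps) m \<noteq> 0}"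
    by (rule finite_subset) simp
qed

lemma finite_contained_in: "finite {\<alpha>. composition \<alpha> \<and> contained_in \<alpha> \<mu>}"
proof (rule finite_subset)
  show "{\<alpha>. composition \<alpha> \<and> contained_in \<alpha> \<mu>}
          \<subseteq> {\<alpha>. set \<alpha> \<subseteq> {..Max (set \<mu>)} \<and> length \<alpha> = length \<mu>}"
  proof (clarsimp simp: contained_in_def)
    fix \<alpha> x
    assume len: "length \<alpha> = length \<mu>" and le: "\<forall>i<length \<mu>. \<alpha> ! i \<le> \<mu> ! i" and "x \<in> set \<alpha>"
    then obtain i where i: "i < length \<mu>" "x = \<alpha> ! i" by (metis in_set_conv_nth)
    have "\<mu> ! i \<le> Max (set \<mu>)" using i by simp
    then show "x \<le> Max (set \<mu>)" using i le by (meson le_trans)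
  qed
qed (simp add: finite_lists_length_eq)

text \<open>A graph is a pair of a vertex set and a set of edges, an edge \<open>uv\<close> being the set \<open>{u, v}\<close>.\<close>

type_synonym 'v graph = "'v set \<times> 'v set set"

text \<open>
  Colourings are functions on the vertex set; extensionality (\<open>\<rightarrow>\<^sub>E\<close>) fixes their irrelevant values
  outside it, so that each colouring is counted once.
\<close>

definition proper_colourings :: "'v graph \<Rightarrow> ('v \<Rightarrow> nat) set" where
  "proper_colourings G =
     {\<kappa> \<in> fst G \<rightarrow>\<^sub>E {1..}. \<forall>u \<in> fst G. \<forall>v \<in> fst G. {u, v} \<in> snd G \<longrightarrow> \<kappa> u \<noteq> \<kappa> v}"

definition chromatic :: "'v graph \<Rightarrow> 'a::comm_ring_1 mps" where
  "chromatic G = mps_infsum (\<lambda>\<kappa>. \<Prod>v \<in> fst G. mps_var (\<kappa> v)) (proper_colourings G)"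

lemma chromatic_summable:
  assumes fin: "finite (fst G)"
  shows "mps_summable (\<lambda>\<kappa>. \<Prod>v \<in> fst G. mps_var (\<kappa> v) :: 'a::comm_ring_1 mps) (proper_colourings G)"
  unfolding mps_summable_def
proof
  fix m :: "nat multiset"
  have "{\<kappa> \<in> proper_colourings G. mps_coeff (\<Prod>v \<in> fst G. mps_var (\<kappa> v) :: 'a mps) m \<noteq> 0}
          \<subseteq> fst G \<rightarrow>\<^sub>E set_mset m"
    using fin by (auto simp: mps_prod_var mps_monom_def proper_colourings_def PiE_iff extensional_def)
  then show "finite {\<kappa> \<in> proper_colourings G. mps_coeff (\<Prod>v \<in> fst G. mps_var (\<kappa> v) :: 'a mps) m \<noteq> 0}"
    by (rule finite_subset) (use fin in \<open>auto intro: finite_PiE\<close>)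
qed

definition star :: "nat \<Rightarrow> nat graph" where
  "star n = ({1..n}, {{i, n} | i. 1 \<le> i \<and> i \<le> n - 1})"

definition disjoint_union :: "'v graph list \<Rightarrow> (nat \<times> 'v) graph" where
  "disjoint_union Gs =
     ((\<Union>k < length Gs. Pair k ` fst (Gs ! k)),
      (\<Union>k < length Gs. (\<lambda>e. Pair k ` e) ` snd (Gs ! k)))"

definition stars :: "nat list \<Rightarrow> (nat \<times> nat) graph" where
  "stars \<mu> = disjoint_union (map star \<mu>)"

end

theory Submission
  imports Defs
begin

text \<open>
  Everything reduces to finitely many variables \<open>x\<^sub>j\<close>, \<open>j \<in> J\<close>, since setting the other
  variables to \<open>0\<close> is a ring homomorphism and these homomorphisms jointly separate power series.
  Colouring the centre of a star first gives \<open>X\<^bsub>S\<^sub>n\<^esub> = \<Sum>\<^sub>j x\<^sub>j (p\<^sub>1 - x\<^sub>j)\<^sup>n\<^sup>-\<^sup>1\<close>, while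
  \<open>p\<^sub>n = \<Sum>\<^sub>j x\<^sub>j (p\<^sub>1 - (p\<^sub>1 - x\<^sub>j))\<^sup>n\<^sup>-\<^sup>1\<close>. Expanding both by the binomial theorem yields the
  two formulas for one part, and multiplicativity over disjoint unions yields the general case.
\<close>

section \<open>Restriction to a set of variables\<close>

text \<open>This is the substitution of 0 for every variable outside \<open>S\<close>.\<close>

definition mps_restrict :: "nat set \<Rightarrow> 'a::comm_ring_1 mps \<Rightarrow> 'a mps" where
  "mps_restrict S f = Abs_mps (\<lambda>m. if set_mset m \<subseteq> S then mps_coeff f m else 0)"

lemma mps_coeff_restrict [simp]:
  "mps_coeff (mps_restrict S f) m = (if set_mset m \<subseteq> S then mps_coeff f m else 0)"
  by (simp add: mps_restrict_def)

text \<open>A monomial involves finitely many variables, so its coefficient survives restriction to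
  exactly those variables.\<close>

lemma mps_eqI_restrict:
  assumes "\<And>S. finite S \<Longrightarrow> mps_restrict S f = mps_restrict S g"
  shows "f = g"
proof (rule mps_eqI)
  fix m
  show "mps_coeff f m = mps_coeff g m"
    using arg_cong [OF assms [of "set_mset m"], of "\<lambda>h. mps_coeff h m"] by simp
qed

lemma mps_coeff_sum: "mps_coeff (\<Sum>i\<in>I. f i) m = (\<Sum>i\<in>I. mps_coeff (f i) m)"
  by (induction I rule: infinite_finite_induct) (simp_all add: zero_mps_def plus_mps_def)

lemma mps_restrict_0 [simp]: "mps_restrict S 0 = 0"
  by (rule mps_eqI) (simp add: zero_mps_def)

lemma mps_restrict_1 [simp]: "mps_restrict S 1 = 1"
  by (rule mps_eqI) (auto simp: one_mps_def)

lemma mps_restrict_add [simp]: "mps_restrict S (f + g) = mps_restrict S f + mps_restrict S g"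
  by (rule mps_eqI) (simp add: plus_mps_def)

lemma mps_restrict_uminus [simp]: "mps_restrict S (- f) = - mps_restrict S f"
  by (rule mps_eqI) (simp add: uminus_mps_def)

text \<open>The variables of a monomial are those of its two factors together, so it lies over
  \<open>S\<close> exactly if both factors do.\<close>

lemma mps_restrict_mult [simp]: "mps_restrict S (f * g) = mps_restrict S f * mps_restrict S g"
proof (rule mps_eqI)
  fix m
  show "mps_coeff (mps_restrict S (f * g)) m = mps_coeff (mps_restrict S f * mps_restrict S g) m"
  proof (cases "set_mset m \<subseteq> S")
    case True
    then have "set_mset a \<subseteq> S" "set_mset (m - a) \<subseteq> S" if "a \<subseteq># m" for a
      using that by (auto dest: mset_subset_eqD in_diffD)
    then show ?thesis
      using True by (auto simp: times_mps_def intro!: sum.cong)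
  next
    case False
    have "\<not> set_mset a \<subseteq> S \<or> \<not> set_mset (m - a) \<subseteq> S" if "a \<subseteq># m" for a
      using that False by (metis Un_least set_mset_union subset_mset.add_diff_inverse)
    then have "mps_coeff (mps_restrict S f * mps_restrict S g) m = 0"
      unfolding times_mps_def mps_coeff_Abs by (intro sum.neutral) auto
    then show ?thesis using False by simp
  qed
qed

lemma mps_restrict_power [simp]: "mps_restrict S (f ^ n) = mps_restrict S f ^ n"
  by (induction n) simp_all

lemma mps_restrict_of_nat [simp]: "mps_restrict S (of_nat n) = of_nat n"
  by (induction n) simp_all

lemma mps_restrict_sum [simp]: "mps_restrict S (\<Sum>i\<in>I. f i) = (\<Sum>i\<in>I. mps_restrict S (f i))"
  by (induction I rule: infinite_finite_induct) simp_all

lemma mps_restrict_prod [simp]: "mps_restrict S (\<Prod>i\<in>I. f i) = (\<Prod>i\<in>I. mps_restrict S (f i))"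
  by (induction I rule: infinite_finite_induct) simp_all

lemma mps_restrict_var [simp]:
  "mps_restrict S (mps_var j) = (if j \<in> S then mps_var j else 0)"
  by (rule mps_eqI) (auto simp: mps_var_def mps_monom_def zero_mps_def)

text \<open>At a monomial over \<open>S\<close> only indices in \<open>I'\<close> contribute, so the
  coefficientwise infinite sum becomes a finite sum open to ordinary ring algebra.\<close>

lemma mps_restrict_infsum:
  assumes "finite I'" "I' \<subseteq> I" and 0: "\<And>i. i \<in> I - I' \<Longrightarrow> mps_restrict S (f i) = 0"
  shows "mps_restrict S (mps_infsum f I) = (\<Sum>i\<in>I'. mps_restrict S (f i))"
proof (rule mps_eqI)
  fix m
  show "mps_coeff (mps_restrict S (mps_infsum f I)) m =
        mps_coeff (\<Sum>i\<in>I'. mps_restrict S (f i)) m"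
  proof (cases "set_mset m \<subseteq> S")
    case True
    have *: "mps_coeff (f i) m = 0" if "i \<in> I - I'" for i
      using arg_cong [OF 0 [OF that], of "\<lambda>h. mps_coeff h m"] True by (simp add: zero_mps_def)
    have "(\<Sum>i | i \<in> I \<and> mps_coeff (f i) m \<noteq> 0. mps_coeff (f i) m) = (\<Sum>i\<in>I'. mps_coeff (f i) m)"
      using assms(1,2) * by (intro sum.mono_neutral_left) auto
    then show ?thesis
      using True by (simp add: mps_infsum_def mps_coeff_sum)
  qed (simp add: mps_coeff_sum)
qed

text \<open>For \<open>j\<close> outside \<open>S\<close> the summand restricts to
  \<open>0 ^ i\<close>, which vanishes because \<open>i\<close> is positive.\<close>

lemma mps_restrict_power_sum:
  assumes "finite S" "1 \<le> i"
  shows "mps_restrict S (power_sum i) = (\<Sum>j \<in> S \<inter> {1..}. mps_var j ^ i)"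
  unfolding power_sum_def using assms
  by (subst mps_restrict_infsum [where I' = "S \<inter> {1..}"]) (auto simp: zero_power)

text \<open>A colouring that uses a colour outside \<open>S\<close> has a zero factor in its
  restricted monomial; finitely many colourings remain.\<close>

lemma mps_restrict_chromatic:
  assumes "finite S" "finite (fst G)"
  shows "mps_restrict S (chromatic G :: 'a::comm_ring_1 mps) =
    (\<Sum>\<kappa> \<in> proper_colourings G \<inter> (fst G \<rightarrow>\<^sub>E S \<inter> {1..}). \<Prod>v \<in> fst G. mps_var (\<kappa> v))"
proof -
  have "mps_restrict S (\<Prod>v \<in> fst G. mps_var (\<kappa> v) :: 'a mps) = 0"
    if \<kappa>: "\<kappa> \<in> proper_colourings G - (fst G \<rightarrow>\<^sub>E S \<inter> {1..})" for \<kappa>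
  proof -
    obtain v where "v \<in> fst G" "\<kappa> v \<notin> S"
      using \<kappa> by (auto simp: proper_colourings_def PiE_iff)
    then show ?thesis using assms(2) by (auto intro!: prod_zero)
  qed
  then show ?thesis unfolding chromatic_def using assms
    by (subst mps_restrict_infsum
          [where I' = "proper_colourings G \<inter> (fst G \<rightarrow>\<^sub>E S \<inter> {1..})"])
       (auto simp: PiE_iff finite_PiE intro!: sum.cong prod.cong)
qed

section \<open>Colourings of disjoint unions and stars\<close>

lemma disjoint_union_edge_iff:
  "{(k, u), (l, v)} \<in> snd (disjoint_union Gs) \<longleftrightarrow>
     k < length Gs \<and> k = l \<and> {u, v} \<in> snd (Gs ! k)"
proof
  assume "{(k, u), (l, v)} \<in> snd (disjoint_union Gs)"
  then obtain i e where i: "i < length Gs" "e \<in> snd (Gs ! i)" and e: "{(k, u), (l, v)} = Pair i ` e"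
    by (auto simp: disjoint_union_def)
  have "snd ` {(k, u), (l, v)} = e" unfolding e by (simp add: image_image)
  moreover have "(k, u) \<in> Pair i ` e" "(l, v) \<in> Pair i ` e" by (simp_all flip: e)
  ultimately show "k < length Gs \<and> k = l \<and> {u, v} \<in> snd (Gs ! k)" using i by auto
next
  assume "k < length Gs \<and> k = l \<and> {u, v} \<in> snd (Gs ! k)"
  then show "{(k, u), (l, v)} \<in> snd (disjoint_union Gs)"
    by (auto simp: disjoint_union_def intro!: bexI [of _ k] image_eqI [of _ _ "{u, v}"])
qed

lemma fst_disjoint_union: "fst (disjoint_union Gs) = (SIGMA k:{..<length Gs}. fst (Gs ! k))"
  by (auto simp: disjoint_union_def)

text \<open>No edge joins different components, so a proper colouring of the union is an independent
  choice of one for each component; the distributive law does the rest.\<close>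

lemma sum_colourings_disjoint_union:
  fixes x :: "nat \<Rightarrow> 'a::comm_ring_1"
  assumes "finite J" and fin: "\<And>k. k < length Gs \<Longrightarrow> finite (fst (Gs ! k))"
  shows "(\<Sum>\<kappa> \<in> proper_colourings (disjoint_union Gs) \<inter> (fst (disjoint_union Gs) \<rightarrow>\<^sub>E J).
            \<Prod>v \<in> fst (disjoint_union Gs). x (\<kappa> v)) =
         (\<Prod>k<length Gs. \<Sum>\<kappa> \<in> proper_colourings (Gs ! k) \<inter> (fst (Gs ! k) \<rightarrow>\<^sub>E J).
            \<Prod>v \<in> fst (Gs ! k). x (\<kappa> v))"
    (is "?L = ?R")
proof -
  let ?K = "{..<length Gs}"
  let ?V = "\<lambda>k. fst (Gs ! k)"
  let ?C = "\<lambda>k. proper_colourings (Gs ! k) \<inter> (?V k \<rightarrow>\<^sub>E J)"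
  have finC: "finite (?C k)" if "k \<in> ?K" for k
    using that assms by (auto intro: finite_PiE)
  have "?R = (\<Sum>d \<in> PiE ?K ?C. \<Prod>k\<in>?K. \<Prod>v \<in> ?V k. x (d k v))"
    by (rule prod_sum_PiE) (use finC in auto)
  also have "\<dots> = (\<Sum>d \<in> PiE ?K ?C. \<Prod>(k, v) \<in> Sigma ?K ?V. x (d k v))"
    using fin by (intro sum.cong refl prod.Sigma) auto
  also have "\<dots> = ?L"
    unfolding fst_disjoint_union
  \<comment> \<open>The bijection is currying. Each level is restricted to its domain to keep the
    functions extensional.\<close>
  proof (rule sum.reindex_bij_witness
      [of _ "\<lambda>\<kappa>. \<lambda>k\<in>?K. \<lambda>v\<in>?V k. \<kappa> (k, v)" "\<lambda>d. \<lambda>(k, v)\<in>Sigma ?K ?V. d k v"])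
    fix d assume d: "d \<in> PiE ?K ?C"
    show "(\<lambda>k\<in>?K. \<lambda>v\<in>?V k. (\<lambda>(k, v)\<in>Sigma ?K ?V. d k v) (k, v)) = d"
    proof
      fix k
      show "(\<lambda>k\<in>?K. \<lambda>v\<in>?V k. (\<lambda>(k, v)\<in>Sigma ?K ?V. d k v) (k, v)) k = d k"
      proof (cases "k \<in> ?K")
        case True
        \<comment> \<open>Extensionality of the inner function settles the values at vertices
          outside component \<open>k\<close>.\<close>
        then have "d k \<in> extensional (?V k)" using d by (auto simp: PiE_iff)
        then show ?thesis using True by (auto simp: fun_eq_iff extensional_def)
      next
        case False
        then show ?thesis using d by (auto simp: PiE_iff extensional_def)
      qed
    qed
    show "(\<lambda>(k, v)\<in>Sigma ?K ?V. d k v) \<in>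
        proper_colourings (disjoint_union Gs) \<inter> (Sigma ?K ?V \<rightarrow>\<^sub>E J)"
      using d unfolding proper_colourings_def
      by (fastforce simp: PiE_iff fst_disjoint_union disjoint_union_edge_iff)
    show "(\<Prod>v\<in>Sigma ?K ?V. x ((\<lambda>(k, v)\<in>Sigma ?K ?V. d k v) v)) =
        (\<Prod>(k, v)\<in>Sigma ?K ?V. x (d k v))"
      by (rule prod.cong) auto
  next
    fix \<kappa> assume \<kappa>: "\<kappa> \<in> proper_colourings (disjoint_union Gs) \<inter> (Sigma ?K ?V \<rightarrow>\<^sub>E J)"
    show "(\<lambda>(k, v)\<in>Sigma ?K ?V. (\<lambda>k\<in>?K. \<lambda>v\<in>?V k. \<kappa> (k, v)) k v) = \<kappa>"
      using \<kappa> by (auto simp: fun_eq_iff PiE_iff extensional_def)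
    show "(\<lambda>k\<in>?K. \<lambda>v\<in>?V k. \<kappa> (k, v)) \<in> PiE ?K ?C"
      using \<kappa> by (auto simp: proper_colourings_def PiE_iff fst_disjoint_union disjoint_union_edge_iff)
  qed
  finally show ?thesis ..
qed

lemma chromatic_disjoint_union:
  assumes "\<And>k. k < length Gs \<Longrightarrow> finite (fst (Gs ! k))"
  shows "(chromatic (disjoint_union Gs) :: 'a::comm_ring_1 mps) = (\<Prod>k<length Gs. chromatic (Gs ! k))"
proof (rule mps_eqI_restrict)
  fix S :: "nat set" assume S: "finite S"
  have "finite (fst (disjoint_union Gs))"
    unfolding fst_disjoint_union using assms by auto
  then show "mps_restrict S (chromatic (disjoint_union Gs) :: 'a mps) =
      mps_restrict S (\<Prod>k<length Gs. chromatic (Gs ! k))"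
    using S assms by (simp add: mps_restrict_chromatic sum_colourings_disjoint_union)
qed

text \<open>This has the same multiplicative form as \<open>power_sums\<close>, so a single lemma on
  products over parts can serve both expansions.\<close>

lemma chromatic_stars:
  "(chromatic (stars \<mu>) :: 'a::comm_ring_1 mps) = prod_list (map (\<lambda>n. chromatic (star n)) \<mu>)"
proof -
  have "(chromatic (stars \<mu>) :: 'a mps) = (\<Prod>k<length \<mu>. chromatic (star (\<mu> ! k)))"
    unfolding stars_def by (subst chromatic_disjoint_union) (simp_all add: star_def)
  also have "\<dots> = prod_list (map (\<lambda>n. chromatic (star n)) \<mu>)"
    by (simp add: prod.list_conv_set_nth atLeast0LessThan)
  finally show ?thesis .
qed

lemma proper_colourings_star:
  assumes "1 \<le> n"
  shows "proper_colourings (star n) =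
           {\<kappa> \<in> {1..n} \<rightarrow>\<^sub>E {1..}. \<forall>i\<in>{1..<n}. \<kappa> i \<noteq> \<kappa> n}"
  using assms by (force simp: proper_colourings_def star_def doubleton_eq_iff)

text \<open>Once the centre \<open>n\<close> has colour \<open>j\<close>, the \<open>n - 1\<close>
  leaves independently take any colour of \<open>J\<close> other than \<open>j\<close>.\<close>

lemma sum_colourings_star:
  fixes x :: "nat \<Rightarrow> 'a::comm_ring_1"
  assumes "finite J" "J \<subseteq> {1..}" and n: "1 \<le> n"
  shows "(\<Sum>\<kappa> \<in> proper_colourings (star n) \<inter> ({1..n} \<rightarrow>\<^sub>E J). \<Prod>v\<in>{1..n}. x (\<kappa> v)) =
         (\<Sum>j\<in>J. x j * ((\<Sum>i\<in>J. x i) - x j) ^ (n - 1))"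
proof -
  have ins: "{1..n} = insert n {1..<n}" using n by auto
  have "(\<Sum>j\<in>J. x j * ((\<Sum>i\<in>J. x i) - x j) ^ (n - 1)) =
        (\<Sum>j\<in>J. x j * (\<Prod>i\<in>{1..<n}. \<Sum>i\<in>J - {j}. x i))"
    using assms by (intro sum.cong refl) (simp add: sum_diff1)
  \<comment> \<open>The power was written as a product over the leaves so that it expands into
    colourings \<open>c\<close> of the leaves; \<open>prod_constant\<close> would fold it back into
    a power.\<close>
  also have "\<dots> = (\<Sum>j\<in>J. \<Sum>c \<in> {1..<n} \<rightarrow>\<^sub>E J - {j}. x j * (\<Prod>i\<in>{1..<n}. x (c i)))"
    using assms by (simp add: prod_sum_PiE sum_distrib_left del: prod_constant)
  also have "\<dots> = (\<Sum>(j, c) \<in> (SIGMA j:J. {1..<n} \<rightarrow>\<^sub>E J - {j}). x j * (\<Prod>i\<in>{1..<n}. x (c i)))"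
    using assms by (intro sum.Sigma) (auto intro: finite_PiE)
  also have "\<dots> = (\<Sum>\<kappa> \<in> proper_colourings (star n) \<inter> ({1..n} \<rightarrow>\<^sub>E J). \<Prod>v\<in>{1..n}. x (\<kappa> v))"
  proof (rule sum.reindex_bij_witness
      [of _ "\<lambda>\<kappa>. (\<kappa> n, restrict \<kappa> {1..<n})" "\<lambda>(j, c). c(n := j)"])
    fix a assume a: "a \<in> (SIGMA j:J. {1..<n} \<rightarrow>\<^sub>E J - {j})"
    obtain j c where jc: "a = (j, c)" by fastforce
    have j: "j \<in> J" and c: "c \<in> extensional {1..<n}" "\<And>i. i \<in> {1..<n} \<Longrightarrow> c i \<in> J - {j}"
      using a by (auto simp: jc PiE_iff)
    have "(\<Prod>v\<in>{1..<n}. x ((c(n := j)) v)) = (\<Prod>v\<in>{1..<n}. x (c v))"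
      by (rule prod.cong) auto
    then show "(\<Prod>v\<in>{1..n}. x ((case a of (j, c) \<Rightarrow> c(n := j)) v)) =
        (case a of (j, c) \<Rightarrow> x j * (\<Prod>i\<in>{1..<n}. x (c i)))"
      unfolding jc ins by simp
    show "((case a of (j, c) \<Rightarrow> c(n := j)) n, restrict (case a of (j, c) \<Rightarrow> c(n := j)) {1..<n}) = a"
      using c by (auto simp: jc fun_eq_iff extensional_def)
    have "(c(n := j)) i \<in> J \<inter> {1..}" if "i \<in> {1..n}" for i
      using that j c(2) [of i] assms(2) by (cases "i = n") auto
    moreover have "(c(n := j)) \<in> extensional {1..n}"
      using c(1) n by (auto simp: extensional_def)
    moreover have "(c(n := j)) i \<noteq> j" if "i \<in> {1..<n}" for i
      using that c(2) by auto
    ultimately show "(case a of (j, c) \<Rightarrow> c(n := j)) \<in>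
        proper_colourings (star n) \<inter> ({1..n} \<rightarrow>\<^sub>E J)"
      unfolding proper_colourings_star [OF n] jc by (auto simp: PiE_iff)
  next
    fix \<kappa> assume "\<kappa> \<in> proper_colourings (star n) \<inter> ({1..n} \<rightarrow>\<^sub>E J)"
    then have \<kappa>: "\<kappa> \<in> extensional {1..n}" "\<And>i. i \<in> {1..n} \<Longrightarrow> \<kappa> i \<in> J"
        "\<And>i. i \<in> {1..<n} \<Longrightarrow> \<kappa> i \<noteq> \<kappa> n"
      unfolding proper_colourings_star [OF n] by (auto simp: PiE_iff)
    show "(case (\<kappa> n, restrict \<kappa> {1..<n}) of (j, c) \<Rightarrow> c(n := j)) = \<kappa>"
      using \<kappa>(1) by (auto simp: fun_eq_iff extensional_def)
    show "(\<kappa> n, restrict \<kappa> {1..<n}) \<in> (SIGMA j:J. {1..<n} \<rightarrow>\<^sub>E J - {j})"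
      using \<kappa>(2,3) n by (auto simp: PiE_iff)
  qed
  finally show ?thesis ..
qed

lemma mps_restrict_chromatic_star:
  assumes "finite S" "1 \<le> n"
  shows "mps_restrict S (chromatic (star n) :: 'a::comm_ring_1 mps) =
    (\<Sum>j\<in>S \<inter> {1..}. mps_var j * ((\<Sum>i\<in>S \<inter> {1..}. mps_var i) - mps_var j) ^ (n - 1))"
proof -
  have "fst (star n) = {1..n}" by (simp add: star_def)
  then show ?thesis
    using assms by (simp add: mps_restrict_chromatic sum_colourings_star del: One_nat_def)
qed

section \<open>Expansions for a single part\<close>

text \<open>Both one-part formulas are instances, with \<open>x j\<close> the variable and
  \<open>p\<close> the sum of the variables: \<open>y j = x j\<close> expands stars in power sums,
  and \<open>y j = p - x j\<close> expands power sums in stars.\<close>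

lemma sum_binomial_expansion:
  fixes x y :: "'j \<Rightarrow> 'a::comm_ring_1"
  assumes n: "1 \<le> n"
  shows "(\<Sum>j\<in>J. x j * (p - y j) ^ (n - 1)) =
    (\<Sum>k=1..n. (-1) ^ (k - 1) * of_nat ((n - 1) choose (k - 1)) *
        (\<Sum>j\<in>J. x j * y j ^ (k - 1)) * p ^ (n - k))"
proof -
  obtain m where m: "n = Suc m" using n by (cases n) auto
  have "x j * (p - y j) ^ m = (\<Sum>k\<le>m. (-1) ^ k * of_nat (m choose k) * (x j * y j ^ k) * p ^ (m - k))"
    for j
  proof -
    \<comment> \<open>With this order of the summands, \<open>binomial_ring\<close> puts the
      exponent \<open>k\<close> on \<open>- y j\<close>, which produces the sign.\<close>
    have "(p - y j) ^ m = (- y j + p) ^ m" by simp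
    also have "\<dots> = (\<Sum>k\<le>m. of_nat (m choose k) * (- y j) ^ k * p ^ (m - k))"
      by (rule binomial_ring)
    finally show ?thesis
      by (auto simp: sum_distrib_left power_minus [of "y j"] mult_ac intro!: sum.cong)
  qed
  then have "(\<Sum>j\<in>J. x j * (p - y j) ^ (n - 1)) =
      (\<Sum>k\<le>m. \<Sum>j\<in>J. (-1) ^ k * of_nat (m choose k) * (x j * y j ^ k) * p ^ (m - k))"
    by (simp add: m sum.swap [of _ J])
  also have "\<dots> = (\<Sum>k\<le>m. (-1) ^ k * of_nat (m choose k) * (\<Sum>j\<in>J. x j * y j ^ k) * p ^ (m - k))"
    by (simp add: sum_distrib_left sum_distrib_right)
  also have "\<dots> = (\<Sum>k=1..n. (-1) ^ (k - 1) * of_nat ((n - 1) choose (k - 1)) *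
        (\<Sum>j\<in>J. x j * y j ^ (k - 1)) * p ^ (n - k))"
    \<comment> \<open>The index is shifted by one so that \<open>k\<close> becomes the size of a
      part, the factor \<open>x j\<close> supplying the missing degree.\<close>
    by (rule sum.reindex_bij_witness [of _ "\<lambda>k. k - 1" Suc]) (auto simp: m)
  finally show ?thesis .
qed

lemma sum_times_power_pred:
  fixes x :: "'j \<Rightarrow> 'a::comm_ring_1"
  assumes "1 \<le> n"
  shows "(\<Sum>j\<in>J. x j * x j ^ (n - 1)) = (\<Sum>j\<in>J. x j ^ n)"
  using assms by (cases n) auto

lemma chromatic_star_expansion:
  assumes n: "1 \<le> n"
  shows "(chromatic (star n) :: 'a::comm_ring_1 mps) =
    (\<Sum>k=1..n. (-1) ^ (k - 1) * of_nat ((n - 1) choose (k - 1)) * power_sum k * power_sum 1 ^ (n - k))"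
proof (rule mps_eqI_restrict)
  fix S :: "nat set" assume S: "finite S"
  let ?J = "S \<inter> {1..}"
  have "mps_restrict S (chromatic (star n) :: 'a mps) =
      (\<Sum>k=1..n. (-1) ^ (k - 1) * of_nat ((n - 1) choose (k - 1)) *
        (\<Sum>j\<in>?J. mps_var j * mps_var j ^ (k - 1)) * (\<Sum>i\<in>?J. mps_var i) ^ (n - k))"
    unfolding mps_restrict_chromatic_star [OF S n] by (rule sum_binomial_expansion [OF n])
  also have "\<dots> = mps_restrict S (\<Sum>k=1..n. (-1) ^ (k - 1) * of_nat ((n - 1) choose (k - 1)) *
      power_sum k * power_sum 1 ^ (n - k))"
    using S by (auto simp: mps_restrict_power_sum sum_times_power_pred simp del: One_nat_def
        intro!: sum.cong)
  finally show "mps_restrict S (chromatic (star n) :: 'a mps) = \<dots>" .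
qed

lemma power_sum_expansion:
  assumes n: "1 \<le> n"
  shows "(power_sum n :: 'a::comm_ring_1 mps) =
    (\<Sum>k=1..n. (-1) ^ (k - 1) * of_nat ((n - 1) choose (k - 1)) *
       chromatic (star k) * chromatic (star 1) ^ (n - k))"
proof (rule mps_eqI_restrict)
  fix S :: "nat set" assume S: "finite S"
  let ?J = "S \<inter> {1..}"
  let ?p = "\<Sum>i\<in>?J. mps_var i :: 'a mps"
  \<comment> \<open>Each variable is written as the complement of its complement in
    \<open>?p\<close>; the powers of \<open>?p - mps_var j\<close> then assemble into stars, and
    \<open>?p\<close> itself is the restriction of \<open>chromatic (star 1)\<close>.\<close>
  have "mps_restrict S (power_sum n :: 'a mps) = (\<Sum>j\<in>?J. mps_var j * (?p - (?p - mps_var j)) ^ (n - 1))"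
    using S n by (simp add: mps_restrict_power_sum sum_times_power_pred del: One_nat_def)
  also have "\<dots> = (\<Sum>k=1..n. (-1) ^ (k - 1) * of_nat ((n - 1) choose (k - 1)) *
        (\<Sum>j\<in>?J. mps_var j * (?p - mps_var j) ^ (k - 1)) * ?p ^ (n - k))"
    by (rule sum_binomial_expansion [OF n])
  also have "\<dots> = mps_restrict S (\<Sum>k=1..n. (-1) ^ (k - 1) * of_nat ((n - 1) choose (k - 1)) *
       chromatic (star k) * chromatic (star 1) ^ (n - k))"
    using S by (auto simp: mps_restrict_chromatic_star simp del: One_nat_def intro!: sum.cong)
  finally show "mps_restrict S (power_sum n :: 'a mps) = \<dots>" .
qed

section \<open>Products over the parts\<close>

lemma contained_in_Nil [simp]: "contained_in \<alpha> [] \<longleftrightarrow> \<alpha> = []"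
  by (auto simp: contained_in_def)

lemma contained_in_Cons_iff:
  "contained_in \<alpha> (n # \<mu>) \<longleftrightarrow> (\<exists>k \<beta>. \<alpha> = k # \<beta> \<and> k \<le> n \<and> contained_in \<beta> \<mu>)"
  by (cases \<alpha>) (auto simp: contained_in_def All_less_Suc2)

text \<open>The first part is chosen independently of the rest, matching the expansion of a product
  of two sums.\<close>

lemma compositions_contained_in_Cons:
  "{\<alpha>. composition \<alpha> \<and> contained_in \<alpha> (n # \<mu>)} =
     (\<lambda>(k, \<beta>). k # \<beta>) ` ({1..n} \<times> {\<beta>. composition \<beta> \<and> contained_in \<beta> \<mu>})"
  by (force simp: contained_in_Cons_iff composition_def)

text \<open>This makes the natural-number subtraction in the number of appended ones an honest
  difference.\<close>

lemma contained_in_sum_list_le: "contained_in \<alpha> \<mu> \<Longrightarrow> sum_list \<alpha> \<le> sum_list \<mu>"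
  by (induction \<mu> arbitrary: \<alpha>) (fastforce simp: contained_in_Cons_iff intro: add_mono)+

text \<open>This does the same for the exponent of the sign.\<close>

lemma composition_length_le: "composition \<alpha> \<Longrightarrow> length \<alpha> \<le> sum_list \<alpha>"
  by (induction \<alpha>) (auto simp: composition_def)

text \<open>Multiplying out the one-part expansions amounts to choosing some \<open>k\<close> for
  each part, that is, some \<alpha>; signs and binomials multiply, and the leftover powers of
  \<open>g 1\<close> collect into the appended ones. Keeping \<open>g\<close> and \<open>h\<close>
  abstract lets power sums and stars exchange roles.\<close>

lemma prod_list_map_expansion:
  fixes g h :: "nat \<Rightarrow> 'a::comm_ring_1"
  assumes "composition \<mu>"
    and h: "\<And>n. 1 \<le> n \<Longrightarrow>
      h n = (\<Sum>k=1..n. (-1) ^ (k - 1) * of_nat ((n - 1) choose (k - 1)) * g k * g 1 ^ (n - k))"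
  shows "prod_list (map h \<mu>) =
    (\<Sum>\<alpha> | composition \<alpha> \<and> contained_in \<alpha> \<mu>.
       (-1) ^ (sum_list \<alpha> - length \<mu>) *
       of_nat (\<Prod>i < length \<mu>. (\<mu> ! i - 1) choose (\<alpha> ! i - 1)) *
       prod_list (map g (sort_desc \<alpha> @ replicate (sum_list \<mu> - sum_list \<alpha>) 1)))"
proof -
  \<comment> \<open>The summand is first taken with \<alpha> unsorted, so that it obeys a recursion
    on lists.\<close>
  define c :: "nat list \<Rightarrow> nat list \<Rightarrow> 'a" where
    "c \<mu> \<alpha> = (-1) ^ (sum_list \<alpha> - length \<mu>) *
       of_nat (\<Prod>i < length \<mu>. (\<mu> ! i - 1) choose (\<alpha> ! i - 1)) *
       (prod_list (map g \<alpha>) * g 1 ^ (sum_list \<mu> - sum_list \<alpha>))" for \<mu> \<alpha>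
  have c_Cons: "c (n # \<mu>) (k # \<beta>) =
      (-1) ^ (k - 1) * of_nat ((n - 1) choose (k - 1)) * g k * g 1 ^ (n - k) * c \<mu> \<beta>"
    if "k \<in> {1..n}" "composition \<beta>" "contained_in \<beta> \<mu>" for n k \<beta> \<mu>
  proof -
    have "length \<beta> = length \<mu>" using that(3) by (simp add: contained_in_def)
    then have len: "length \<mu> \<le> sum_list \<beta>"
      using composition_length_le [OF that(2)] by simp
    \<comment> \<open>Both exponents split additively only because no subtraction is truncated:
      \<open>k\<close> is between 1 and \<open>n\<close>, and the two preceding bounds hold for the
      tail.\<close>
    have e1: "k + sum_list \<beta> - length (n # \<mu>) = (k - 1) + (sum_list \<beta> - length \<mu>)"
      using that(1) len by simp
    have e2: "n + sum_list \<mu> - (k + sum_list \<beta>) = (n - k) + (sum_list \<mu> - sum_list \<beta>)"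
      using that(1) contained_in_sum_list_le [OF that(3)] by simp
    have "(\<Prod>i < length (n # \<mu>). ((n # \<mu>) ! i - 1) choose ((k # \<beta>) ! i - 1)) =
        ((n - 1) choose (k - 1)) * (\<Prod>i < length \<mu>. (\<mu> ! i - 1) choose (\<beta> ! i - 1))"
      by (simp add: prod.lessThan_Suc_shift del: prod.lessThan_Suc)
    then show ?thesis
      unfolding c_def sum_list.Cons e1 e2 power_add by (simp add: mult_ac)
  qed
  have "prod_list (map h \<mu>) = (\<Sum>\<alpha> | composition \<alpha> \<and> contained_in \<alpha> \<mu>. c \<mu> \<alpha>)"
    using assms(1)
  proof (induction \<mu>)
    case Nil
    have "{\<alpha>. composition \<alpha> \<and> contained_in \<alpha> []} = {[]}" by (auto simp: composition_def)
    then show ?case by (simp add: c_def)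
  next
    case (Cons n \<mu>)
    let ?B = "{\<beta>. composition \<beta> \<and> contained_in \<beta> \<mu>}"
    have "1 \<le> n" "composition \<mu>" using Cons.prems by (auto simp: composition_def)
    then have "prod_list (map h (n # \<mu>)) =
        (\<Sum>k=1..n. (-1) ^ (k - 1) * of_nat ((n - 1) choose (k - 1)) * g k * g 1 ^ (n - k)) *
        (\<Sum>\<beta>\<in>?B. c \<mu> \<beta>)"
      using Cons.IH h by simp
    also have "\<dots> = (\<Sum>(k, \<beta>)\<in>{1..n} \<times> ?B. c (n # \<mu>) (k # \<beta>))"
      unfolding sum_product sum.cartesian_product by (intro sum.cong) (auto simp: c_Cons)
    also have "\<dots> = (\<Sum>\<alpha> | composition \<alpha> \<and> contained_in \<alpha> (n # \<mu>). c (n # \<mu>) \<alpha>)"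
      unfolding compositions_contained_in_Cons
      by (subst sum.reindex) (auto simp: inj_on_def case_prod_unfold)
    finally show ?case .
  qed
  \<comment> \<open>Sorting only permutes commuting factors, which is seen by passing to the product
    over the multiset.\<close>
  moreover have "prod_list (map g (sort_desc \<alpha> @ replicate m 1)) = prod_list (map g \<alpha>) * g 1 ^ m"
    for \<alpha> m
    unfolding sort_desc_def
    by (simp flip: prod_mset_prod_list add: prod_list_replicate)
  ultimately show ?thesis by (simp add: c_def)
qed

theorem proposition6p6:
  fixes lam :: "nat list"
  assumes "int_partition lam"
  shows "(power_sums lam :: 'a::comm_ring_1 mps) =
           (\<Sum>\<alpha> | composition \<alpha> \<and> contained_in \<alpha> lam.
              (-1) ^ (sum_list \<alpha> - length lam) *
              of_nat (\<Prod>i < length lam. (lam ! i - 1) choose (\<alpha> ! i - 1)) *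
              chromatic (stars (sort_desc \<alpha> @ replicate (sum_list lam - sum_list \<alpha>) 1)))
       \<and> (chromatic (stars lam) :: 'a::comm_ring_1 mps) =
           (\<Sum>\<alpha> | composition \<alpha> \<and> contained_in \<alpha> lam.
              (-1) ^ (sum_list \<alpha> - length lam) *
              of_nat (\<Prod>i < length lam. (lam ! i - 1) choose (\<alpha> ! i - 1)) *
              power_sums (sort_desc \<alpha> @ replicate (sum_list lam - sum_list \<alpha>) 1))"
proof -
  have "composition lam" using assms by (simp add: int_partition_def)
  from prod_list_map_expansion [OF this power_sum_expansion]
    prod_list_map_expansion [OF this chromatic_star_expansion]
  show ?thesis unfolding power_sums_def chromatic_stars by blast
qed

end
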